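(* The complexity of the system of nine linear forms $\Psi:\mathbb{Z}^3\to\mathbb{Z}^9$, $$\Psi(a,b,c)=(a+b,\;a-b-c,\;a+c,\;a-b+c,\;a,\;a+b-c,\;a-c,\;a+b+c,\;a-b),$$ which parametrizes the $3\times3$ $\mathbb{Z}$-magic squares, is $3$.
   Context: A $3\times 3$ $\mathbb{Z}$-magic square is a $3\times 3$ array of integers such that the sum of the entries in every row, every column and each of the two main diagonals is the same; its entries are listed from left to right and from top to bottom. Complexity: let $\Psi=(\psi_1,\dots,\psi_t)$ be a system of linear forms. For an integer $s\ge0$, $\Psi$ has $i$-complexity at most $s$ if one can write the set of $t-1$ forms $\{\psi_1,\dots,\psi_{i-1},\psi_{i+1},\dots,\psi_t\}$ as a union of $s+1$ sets in such a way that $\psi_i$ does not lie in the linear span over $\mathbb{Q}$ of any of these sets (for affine-linear forms one uses the affine-linear span over $\mathbb{Q}$). The complexity of $\Psi$ is the least $s$ for which the system has $i$-complexity at most $s$ for all $1\le i\le t$, or $\infty$ if no such $s$ exists. *)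

theory Defs
  imports "HOL-Analysis.Analysis" "HOL-Library.Function_Algebras" "HOL-Library.Extended_Nat"
begin

global_interpretation rat_fun: vector_space "\<lambda>(q::rat) (f::'a \<Rightarrow> rat) x. q * f x"
  defines rat_span = "rat_fun.span"
  by unfold_locales (auto simp: fun_eq_iff algebra_simps)

definition linear_form :: "(int ^ 'd \<Rightarrow> int) \<Rightarrow> bool" where
  "linear_form \<psi> \<longleftrightarrow> (\<exists>c :: int ^ 'd. \<forall>v. \<psi> v = (\<Sum>j\<in>UNIV. c $ j * v $ j))"

text \<open>
  Integer-valued forms are regarded as rational-valued functions in order to take spans over the
  rationals. Systems of forms are lists, indexed from 0. The covering sets may be empty and may
  overlap.
\<close>

definition i_complexity_at_most :: "(int ^ 'd \<Rightarrow> int) list \<Rightarrow> nat \<Rightarrow> nat \<Rightarrow> bool" where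
  "i_complexity_at_most \<Psi> i s \<longleftrightarrow>
     (\<exists>A :: nat \<Rightarrow> (int ^ 'd \<Rightarrow> int) set.
        (\<Union>k\<in>{0..s}. A k) = {\<Psi> ! j | j. j < length \<Psi> \<and> j \<noteq> i} \<and>
        (\<forall>k\<in>{0..s}. (\<lambda>v. of_int ((\<Psi> ! i) v)) \<notin> rat_span ((\<lambda>\<psi> v. of_int (\<psi> v)) ` A k)))"

definition complexity :: "(int ^ 'd \<Rightarrow> int) list \<Rightarrow> enat" where
  "complexity \<Psi> =
     (if \<exists>s. \<forall>i<length \<Psi>. i_complexity_at_most \<Psi> i s
      then enat (LEAST s. \<forall>i<length \<Psi>. i_complexity_at_most \<Psi> i s)
      else \<infinity>)"

definition magic_square :: "int ^ 3 ^ 3 \<Rightarrow> bool" where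
  "magic_square M \<longleftrightarrow>
     (\<exists>\<sigma>. (\<forall>i. (\<Sum>j\<in>UNIV. M $ i $ j) = \<sigma>) \<and>
          (\<forall>j. (\<Sum>i\<in>UNIV. M $ i $ j) = \<sigma>) \<and>
          M $ 1 $ 1 + M $ 2 $ 2 + M $ 3 $ 3 = \<sigma> \<and>
          M $ 1 $ 3 + M $ 2 $ 2 + M $ 3 $ 1 = \<sigma>)"

definition entries :: "int ^ 3 ^ 3 \<Rightarrow> int list" where
  "entries M =
     [M $ 1 $ 1, M $ 1 $ 2, M $ 1 $ 3,
      M $ 2 $ 1, M $ 2 $ 2, M $ 2 $ 3,
      M $ 3 $ 1, M $ 3 $ 2, M $ 3 $ 3]"

definition magic_forms :: "(int ^ 3 \<Rightarrow> int) list" where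
  "magic_forms =
     (let a = (\<lambda>v. v $ 1); b = (\<lambda>v. v $ 2); c = (\<lambda>v. v $ 3) in
      [\<lambda>v. a v + b v, \<lambda>v. a v - b v - c v, \<lambda>v. a v + c v,
       \<lambda>v. a v - b v + c v, \<lambda>v. a v, \<lambda>v. a v + b v - c v,
       \<lambda>v. a v - c v, \<lambda>v. a v + b v + c v, \<lambda>v. a v - b v])"

end

theory Submission
  imports Defs
begin

text \<open>
  The form \<open>a + x b + y c\<close> is recorded by the point \<open>(x, y)\<close> of the affine plane. The nine forms then
  are the nine points of the grid \<open>{-1, 0, 1} \<times> {-1, 0, 1}\<close>, and a set of forms has a span that
  misses a given form exactly when its points lie on a line of the projective plane that avoids the
  given point. Hence the \<open>i\<close>-complexity is at most \<open>s\<close> if and only if the eight grid points other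
  than the \<open>i\<close>-th can be covered by \<open>s + 1\<close> lines that avoid the \<open>i\<close>-th point.

  Four lines always suffice (\<open>magic_forms_i_complexity_le_3\<close>): of the three horizontal and three
  vertical grid lines, take the four that do not pass through the given point. Any other grid point
  differs from it in a coordinate and so lies on one of them.

  For the centre of the grid three lines do not suffice (\<open>centre_not_covered_by_three\<close>). One of
  three lines would contain two of the four edge midpoints. They are neighbours, since antipodal
  points cannot share a line that avoids the centre, and this line misses all four corners. The other two lines must then be
  opposite sides of the square. The two midpoints still to be covered are neighbours too, so one of
  them is the midpoint of a side perpendicular to these two, and it stays uncovered
  (\<open>centre_not_covered_by_midpoint_line_and_two\<close>).

  The parametrization of magic squares rests on the fact that the centre entry is a third of the
  common sum: the middle row, the middle column and the two diagonals together cover every entry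
  once and the centre three more times.
\<close>

section \<open>Spans of forms and common zeros\<close>

text \<open>Evaluation at a vector is linear, so a common zero of some forms is a zero of their span.\<close>

lemma rat_span_vanishes_at_common_zero:
  assumes "f \<in> rat_span F" and "\<And>g. g \<in> F \<Longrightarrow> g v = 0"
  shows "f v = 0"
  using assms(1)
  by (induction rule: rat_fun.span_induct_alt) (auto simp: assms(2))

text \<open>
  Geometrically, each \<open>w k\<close> is the equation of a hyperplane in the space of forms; the hyperplanes
  avoid \<open>\<Psi> ! i\<close> and together cover the other forms.
\<close>

lemma i_complexity_at_most_if_zeros:
  assumes avoid: "\<And>k. k \<le> s \<Longrightarrow> (\<Psi> ! i) (w k) \<noteq> 0"
    and cover: "\<And>j. j < length \<Psi> \<Longrightarrow> j \<noteq> i \<Longrightarrow> \<exists>k\<le>s. (\<Psi> ! j) (w k) = 0"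
  shows "i_complexity_at_most \<Psi> i s"
proof -
  define A where "A k = {\<Psi> ! j | j. j < length \<Psi> \<and> j \<noteq> i \<and> (\<Psi> ! j) (w k) = 0}" for k
  have "(\<Union>k\<in>{0..s}. A k) = {\<Psi> ! j | j. j < length \<Psi> \<and> j \<noteq> i}"
    using cover unfolding A_def by fastforce
  moreover have "(\<lambda>v. of_int ((\<Psi> ! i) v)) \<notin> rat_span ((\<lambda>\<psi> v. of_int (\<psi> v)) ` A k)"
    if "k \<in> {0..s}" for k
  proof
    assume "(\<lambda>v. of_int ((\<Psi> ! i) v)) \<in> rat_span ((\<lambda>\<psi> v. of_int (\<psi> v)) ` A k)"
    then have "(of_int ((\<Psi> ! i) (w k)) :: rat) = 0"
      by (rule rat_span_vanishes_at_common_zero) (auto simp: A_def)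
    then show False
      using avoid[of k] that by simp
  qed
  ultimately show ?thesis
    unfolding i_complexity_at_most_def by blast
qed

lemma i_complexity_at_most_mono:
  assumes "i_complexity_at_most \<Psi> i s" and "s \<le> t"
  shows "i_complexity_at_most \<Psi> i t"
proof -
  obtain A where A: "(\<Union>k\<in>{0..s}. A k) = {\<Psi> ! j | j. j < length \<Psi> \<and> j \<noteq> i}"
    "\<forall>k\<in>{0..s}. (\<lambda>v. of_int ((\<Psi> ! i) v)) \<notin> rat_span ((\<lambda>\<psi> v. of_int (\<psi> v)) ` A k)"
    using assms(1) unfolding i_complexity_at_most_def by blast
  have "(\<lambda>k. min k s) ` {0..t} = {0..s}"
  proof
    show "{0..s} \<subseteq> (\<lambda>k. min k s) ` {0..t}"
    proof
      fix k assume "k \<in> {0..s}"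
      then have "k = min k s" and "k \<in> {0..t}"
        using assms(2) by auto
      then show "k \<in> (\<lambda>k. min k s) ` {0..t}"
        by (rule image_eqI)
    qed
  qed auto
  then have "(\<Union>k\<in>{0..t}. A (min k s)) = (\<Union>k\<in>{0..s}. A k)"
    by (metis image_image)
  with A show ?thesis
    unfolding i_complexity_at_most_def by (intro exI[of _ "\<lambda>k. A (min k s)"]) auto
qed

section \<open>The nine forms as a grid of points\<close>

definition grid_form :: "int \<times> int \<Rightarrow> int ^ 3 \<Rightarrow> int" where
  "grid_form p v = v $ 1 + fst p * v $ 2 + snd p * v $ 3"

definition grid_points :: "(int \<times> int) list" where
  "grid_points =
     [(1, 0), (-1, -1), (0, 1), (-1, 1), (0, 0), (1, -1), (0, -1), (1, 1), (-1, 0)]"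

lemma magic_forms_eq_grid: "magic_forms = map grid_form grid_points"
  by (simp add: magic_forms_def grid_points_def grid_form_def fun_eq_iff Let_def)

lemma set_grid_points: "set grid_points = {-1, 0, 1} \<times> {-1, 0, 1}"
  unfolding grid_points_def by auto

lemma distinct_grid_points: "distinct grid_points"
  by (simp add: grid_points_def)

lemma length_grid_points: "length grid_points = 9"
  by (simp add: grid_points_def)

lemma linear_form_grid_form: "linear_form (grid_form p)"
  unfolding linear_form_def grid_form_def
  by (intro exI[of _ "vector [1, fst p, snd p]"]) (simp add: sum_3)

section \<open>Four lines suffice\<close>

text \<open>
  The vectors \<open>(-x, 1, 0)\<close> and \<open>(-y, 0, 1)\<close> are the equations of the vertical line at \<open>x\<close> and of the
  horizontal line at \<open>y\<close>.
\<close>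

lemma magic_forms_i_complexity_le_3:
  assumes "i < length magic_forms"
  shows "i_complexity_at_most magic_forms i 3"
proof -
  have len: "length magic_forms = length grid_points"
    by (simp add: magic_forms_eq_grid)
  obtain x y where xy: "grid_points ! i = (x, y)"
    by fastforce
  then have "(x, y) \<in> set grid_points"
    using assms len by (metis nth_mem)
  then have x: "x \<in> {-1, 0, 1}" and y: "y \<in> {-1, 0, 1}"
    by (auto simp: set_grid_points)
  have others: "\<exists>z1 z2. z1 \<noteq> z \<and> z2 \<noteq> z \<and> {-1, 0, 1} \<subseteq> {z, z1, z2}"
    if "z \<in> {-1, 0, 1}" for z :: int
    using that by (intro exI[of _ "if z = -1 then 0 else -1"] exI[of _ "if z = 1 then 0 else 1"]) auto
  obtain x1 x2 where x12: "x1 \<noteq> x" "x2 \<noteq> x" "{-1, 0, 1} \<subseteq> {x, x1, x2}"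
    using others[OF x] by blast
  obtain y1 y2 where y12: "y1 \<noteq> y" "y2 \<noteq> y" "{-1, 0, 1} \<subseteq> {y, y1, y2}"
    using others[OF y] by blast
  define lines :: "(int ^ 3) list" where
    "lines = [vector [-x1, 1, 0], vector [-x2, 1, 0], vector [-y1, 0, 1], vector [-y2, 0, 1]]"
  have length_lines: "length lines = Suc 3"
    by (simp add: lines_def)
  show ?thesis
  proof (rule i_complexity_at_most_if_zeros[where w = "\<lambda>k. lines ! k"])
    fix k :: nat assume "k \<le> 3"
    then have "lines ! k \<in> set lines"
      using length_lines by (intro nth_mem) simp
    then show "(magic_forms ! i) (lines ! k) \<noteq> 0"
      using assms len xy x12(1,2) y12(1,2)
      by (auto simp: lines_def magic_forms_eq_grid grid_form_def)
  next
    fix j assume j: "j < length magic_forms" "j \<noteq> i"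
    obtain x' y' where xy': "grid_points ! j = (x', y')"
      by fastforce
    have "(x', y') \<in> set grid_points"
      using j(1) len xy' by (metis nth_mem)
    then have in_grid: "x' \<in> {x, x1, x2}" "y' \<in> {y, y1, y2}"
      using subsetD[OF x12(3), of x'] subsetD[OF y12(3), of y'] unfolding set_grid_points by auto
    have "(x', y') \<noteq> (x, y)"
      using j assms nth_eq_iff_index_eq[OF distinct_grid_points, of i j] unfolding len xy xy' by auto
    then have "\<exists>w\<in>set lines. grid_form (x', y') w = 0"
      using in_grid by (auto simp: lines_def grid_form_def)
    then obtain k where "k < Suc 3" "grid_form (x', y') (lines ! k) = 0"
      using length_lines by (metis in_set_conv_nth)
    then show "\<exists>k\<le>3. (magic_forms ! j) (lines ! k) = 0"
      using j len xy' by (auto simp: magic_forms_eq_grid intro!: exI[of _ k])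
  qed
qed

section \<open>Three lines do not suffice for the centre\<close>

text \<open>
  The cross product coefficients solve \<open>\<alpha> p + \<beta> q + \<gamma> r = 0\<close> in the plane, so the same combination
  of forms is \<open>\<alpha> + \<beta> + \<gamma>\<close> times the central form. This sum is the determinant of the three forms,
  which is nonzero unless the points are collinear.
\<close>

lemma span_avoids_centre_collinear:
  assumes avoid: "(\<lambda>v. of_int (grid_form (0, 0) v)) \<notin> rat_span ((\<lambda>\<psi> v. of_int (\<psi> v)) ` A)"
    and "grid_form (x1, y1) \<in> A" "grid_form (x2, y2) \<in> A" "grid_form (x3, y3) \<in> A"
  shows "(x2 * y3 - x3 * y2) + (x3 * y1 - x1 * y3) + (x1 * y2 - x2 * y1) = 0"
proof (rule ccontr)
  define \<alpha> \<beta> \<gamma> where "\<alpha> = x2 * y3 - x3 * y2" and "\<beta> = x3 * y1 - x1 * y3"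
    and "\<gamma> = x1 * y2 - x2 * y1"
  define F :: "(int ^ 3 \<Rightarrow> rat) set" where "F = (\<lambda>\<psi> v. of_int (\<psi> v)) ` A"
  define d :: rat where "d = of_int (\<alpha> + \<beta> + \<gamma>)"
  assume "\<not> ?thesis"
  then have d: "d \<noteq> 0"
    unfolding d_def \<alpha>_def \<beta>_def \<gamma>_def of_int_eq_0_iff .
  have scaled: "(\<lambda>v. c * of_int (\<psi> v)) \<in> rat_span F" if "\<psi> \<in> A" for c \<psi>
    using that unfolding F_def
    by (intro rat_fun.span_scale rat_fun.span_base) auto
  have "(\<lambda>v. of_int \<alpha> / d * of_int (grid_form (x1, y1) v)) +
      (\<lambda>v. of_int \<beta> / d * of_int (grid_form (x2, y2) v)) +
      (\<lambda>v. of_int \<gamma> / d * of_int (grid_form (x3, y3) v)) \<in> rat_span F" (is "?f \<in> _")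
    using assms(2-4) by (intro rat_fun.span_add scaled)
  moreover have "?f = (\<lambda>v. of_int (grid_form (0, 0) v))"
  proof
    fix v
    have "\<alpha> * grid_form (x1, y1) v + \<beta> * grid_form (x2, y2) v + \<gamma> * grid_form (x3, y3) v
        = (\<alpha> + \<beta> + \<gamma>) * grid_form (0, 0) v"
      unfolding grid_form_def \<alpha>_def \<beta>_def \<gamma>_def by (simp add: algebra_simps)
    then have "of_int \<alpha> * of_int (grid_form (x1, y1) v) + of_int \<beta> * of_int (grid_form (x2, y2) v)
        + of_int \<gamma> * of_int (grid_form (x3, y3) v) = d * of_int (grid_form (0, 0) v)"
      unfolding d_def of_int_mult[symmetric] of_int_add[symmetric] of_int_eq_iff .
    then show "?f v = of_int (grid_form (0, 0) v)"
      using d by (simp add: divide_simps mult.commute)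
  qed
  ultimately show False
    using avoid unfolding F_def by simp
qed

text \<open>The central form is half the sum of two antipodal forms.\<close>

lemma span_avoids_centre_not_antipodal:
  assumes avoid: "(\<lambda>v. of_int (grid_form (0, 0) v)) \<notin> rat_span ((\<lambda>\<psi> v. of_int (\<psi> v)) ` A)"
    and "grid_form (x, y) \<in> A"
  shows "grid_form (-x, -y) \<notin> A"
proof
  assume "grid_form (-x, -y) \<in> A"
  then have "(\<lambda>v. 1 / 2 * of_int (grid_form (x, y) v)) +
      (\<lambda>v. 1 / 2 * of_int (grid_form (-x, -y) v)) \<in> rat_span ((\<lambda>\<psi> v. of_int (\<psi> v)) ` A)"
    (is "?f \<in> _")
    using assms(2) by (intro rat_fun.span_add rat_fun.span_scale rat_fun.span_base) auto
  moreover have "?f = (\<lambda>v. of_int (grid_form (0, 0) v))"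
    by (auto simp: grid_form_def field_simps)
  ultimately show False
    using avoid by simp
qed

text \<open>
  A collinear set without antipodal pairs, such as the grid points of a line that avoids the centre.
\<close>

definition off_centre_collinear :: "(int \<times> int) set \<Rightarrow> bool" where
  "off_centre_collinear S \<longleftrightarrow>
     (\<forall>x y. (x, y) \<in> S \<longrightarrow> (-x, -y) \<notin> S) \<and>
     (\<forall>x1 y1 x2 y2 x3 y3. (x1, y1) \<in> S \<longrightarrow> (x2, y2) \<in> S \<longrightarrow> (x3, y3) \<in> S \<longrightarrow>
        (x2 * y3 - x3 * y2) + (x3 * y1 - x1 * y3) + (x1 * y2 - x2 * y1) = 0)"

lemma off_centre_collinear_if_span_avoids_centre:
  assumes "(\<lambda>v. of_int (grid_form (0, 0) v)) \<notin> rat_span ((\<lambda>\<psi> v. of_int (\<psi> v)) ` A)"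
  shows "off_centre_collinear {p. grid_form p \<in> A}"
  unfolding off_centre_collinear_def mem_Collect_eq
  using span_avoids_centre_not_antipodal[OF assms] span_avoids_centre_collinear[OF assms] by blast

text \<open>
  Besides antipodal points, the incidences that matter are that a line that avoids the centre cannot
  contain two neighbouring midpoints and a corner, nor the two ends of a side together with the
  midpoint of a side perpendicular to it.
\<close>

lemma off_centre_collinear_incidences:
  assumes "off_centre_collinear S"
  shows off_centre_not_antipodal: "\<And>x y. (x, y) \<in> S \<Longrightarrow> (-x, -y) \<notin> S"
    and off_centre_midpoints_exclude_corner:
      "\<And>u v x y. u \<in> {-1, 1} \<Longrightarrow> v \<in> {-1, 1} \<Longrightarrow> x \<in> {-1, 1} \<Longrightarrow> y \<in> {-1, 1} \<Longrightarrow>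
         (u, 0) \<in> S \<Longrightarrow> (0, v) \<in> S \<Longrightarrow> (x, y) \<notin> S"
    and off_centre_vertical_side:
      "\<And>x u. x \<noteq> 0 \<Longrightarrow> (x, -1) \<in> S \<Longrightarrow> (x, 1) \<in> S \<Longrightarrow> (0, u) \<notin> S"
    and off_centre_horizontal_side:
      "\<And>y u. y \<noteq> 0 \<Longrightarrow> (-1, y) \<in> S \<Longrightarrow> (1, y) \<in> S \<Longrightarrow> (u, 0) \<notin> S"
proof -
  have det: "(x2 * y3 - x3 * y2) + (x3 * y1 - x1 * y3) + (x1 * y2 - x2 * y1) = 0"
    if "(x1, y1) \<in> S" "(x2, y2) \<in> S" "(x3, y3) \<in> S" for x1 y1 x2 y2 x3 y3
    using assms that unfolding off_centre_collinear_def by blast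
  show "(-x, -y) \<notin> S" if "(x, y) \<in> S" for x y
    using assms that unfolding off_centre_collinear_def by blast
  show "(x, y) \<notin> S" if "u \<in> {-1, 1}" "v \<in> {-1, 1}" "x \<in> {-1, 1}" "y \<in> {-1, 1}"
    "(u, 0) \<in> S" "(0, v) \<in> S" for u v x y
    using that(1-4) det[OF that(5,6), of x y] by auto
  show "(0, u) \<notin> S" if "x \<noteq> 0" "(x, -1) \<in> S" "(x, 1) \<in> S" for x u
    using that(1) det[OF that(2,3), of 0 u] by auto
  show "(u, 0) \<notin> S" if "y \<noteq> 0" "(-1, y) \<in> S" "(1, y) \<in> S" for y u
    using that(1) det[OF that(2,3), of u 0] by auto
qed

text \<open>
  The line through two neighbouring midpoints misses all corners. Of two antipodal corners each of the
  other two lines takes one, so these lines are opposite sides. Vertical sides miss the midpoint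
  \<open>(0, -v)\<close> and horizontal ones the midpoint \<open>(-u, 0)\<close>, and the first line misses both.
\<close>

lemma centre_not_covered_by_midpoint_line_and_two:
  assumes S: "off_centre_collinear S" and T: "off_centre_collinear T" and U: "off_centre_collinear U"
    and cover: "({-1, 0, 1} \<times> {-1, 0, 1}) - {(0, 0)} \<subseteq> S \<union> T \<union> U"
    and uv: "u \<in> {-1, 1}" "v \<in> {-1, 1}" and mid: "(u, 0) \<in> S" "(0, v) \<in> S"
  shows False
proof -
  have "(x, y) \<in> T \<or> (x, y) \<in> U" if "x \<in> {-1, 1}" "y \<in> {-1, 1}" for x y
    using off_centre_midpoints_exclude_corner[OF S uv that mid] subsetD[OF cover, of "(x, y)"] that
    by auto
  then have corners: "(1, 1) \<in> T \<or> (1, 1) \<in> U" "(1, -1) \<in> T \<or> (1, -1) \<in> U"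
    "(-1, 1) \<in> T \<or> (-1, 1) \<in> U" "(-1, -1) \<in> T \<or> (-1, -1) \<in> U"
    by auto
  have "(-u, 0) \<notin> S" "(0, -v) \<notin> S"
    using off_centre_not_antipodal[OF S mid(1)] off_centre_not_antipodal[OF S mid(2)] by auto
  moreover have "(-u, 0) \<in> S \<union> T \<union> U" "(0, -v) \<in> S \<union> T \<union> U"
    using subsetD[OF cover, of "(-u, 0)"] subsetD[OF cover, of "(0, -v)"] uv by auto
  ultimately have mids: "(-u, 0) \<in> T \<or> (-u, 0) \<in> U" "(0, -v) \<in> T \<or> (0, -v) \<in> U"
    by auto
  have excluded:
    "\<not> ((1, 1) \<in> V \<and> (-1, -1) \<in> V)" "\<not> ((1, -1) \<in> V \<and> (-1, 1) \<in> V)"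
    "\<not> ((1, -1) \<in> V \<and> (1, 1) \<in> V \<and> (0, -v) \<in> V)"
    "\<not> ((-1, -1) \<in> V \<and> (-1, 1) \<in> V \<and> (0, -v) \<in> V)"
    "\<not> ((-1, 1) \<in> V \<and> (1, 1) \<in> V \<and> (-u, 0) \<in> V)"
    "\<not> ((-1, -1) \<in> V \<and> (1, -1) \<in> V \<and> (-u, 0) \<in> V)"
    if V: "off_centre_collinear V" for V
    using off_centre_not_antipodal[OF V, of 1 1] off_centre_not_antipodal[OF V, of 1 "-1"]
      off_centre_vertical_side[OF V, of 1 "-v"] off_centre_vertical_side[OF V, of "-1" "-v"]
      off_centre_horizontal_side[OF V, of 1 "-u"] off_centre_horizontal_side[OF V, of "-1" "-u"]
    by auto
  show False
    using corners mids excluded[OF T] excluded[OF U] by sat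
qed

text \<open>Two of the four midpoints lie in the same set, and they are neighbours.\<close>

lemma centre_not_covered_by_three:
  assumes S: "off_centre_collinear S" and T: "off_centre_collinear T" and U: "off_centre_collinear U"
    and cover: "({-1, 0, 1} \<times> {-1, 0, 1}) - {(0, 0)} \<subseteq> S \<union> T \<union> U"
  shows False
proof -
  have "(1, 0) \<in> S \<union> T \<union> U" "(-1, 0) \<in> S \<union> T \<union> U"
    "(0, 1) \<in> S \<union> T \<union> U" "(0, -1) \<in> S \<union> T \<union> U"
    by (rule subsetD[OF cover], simp)+
  moreover have "\<not> ((1, 0) \<in> V \<and> (-1, 0) \<in> V)" "\<not> ((0, 1) \<in> V \<and> (0, -1) \<in> V)"
    if V: "off_centre_collinear V" for V
    using off_centre_not_antipodal[OF V, of 1 0] off_centre_not_antipodal[OF V, of 0 1] by auto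
  ultimately have "\<exists>V\<in>{S, T, U}. \<exists>u\<in>{-1, 1}. \<exists>v\<in>{-1, 1}. (u, 0) \<in> V \<and> (0, v) \<in> V"
    using S T U by simp blast
  then obtain V u v where V: "V \<in> {S, T, U}"
    and uv: "u \<in> {-1, 1}" "v \<in> {-1, 1}" and mid: "(u, 0) \<in> V" "(0, v) \<in> V"
    by blast
  from V consider "V = S" | "V = T" | "V = U"
    by blast
  then show False
  proof cases
    case 1
    show False
      by (rule centre_not_covered_by_midpoint_line_and_two[OF S T U cover uv mid[unfolded 1]])
  next
    case 2
    have "({-1, 0, 1} \<times> {-1, 0, 1}) - {(0, 0)} \<subseteq> T \<union> S \<union> U"
      using cover by blast
    then show False
      by (rule centre_not_covered_by_midpoint_line_and_two[OF T S U _ uv mid[unfolded 2]])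
  next
    case 3
    have "({-1, 0, 1} \<times> {-1, 0, 1}) - {(0, 0)} \<subseteq> U \<union> S \<union> T"
      using cover by blast
    then show False
      by (rule centre_not_covered_by_midpoint_line_and_two[OF U S T _ uv mid[unfolded 3]])
  qed
qed

text \<open>The central form has index 4 in the list.\<close>

lemma magic_forms_centre_not_i_complexity_2: "\<not> i_complexity_at_most magic_forms 4 2"
proof
  assume "i_complexity_at_most magic_forms 4 2"
  then obtain A where A: "(\<Union>k\<in>{0..2::nat}. A k) = {magic_forms ! j | j. j < length magic_forms \<and> j \<noteq> 4}"
    and avoid: "\<forall>k\<in>{0..2}. (\<lambda>v. of_int ((magic_forms ! 4) v)) \<notin> rat_span ((\<lambda>\<psi> v. of_int (\<psi> v)) ` A k)"
    unfolding i_complexity_at_most_def by blast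
  define S where "S k = {p. grid_form p \<in> A k}" for k
  have centre: "magic_forms ! 4 = grid_form (0, 0)"
    by (simp add: magic_forms_eq_grid grid_points_def)
  have lines: "off_centre_collinear (S k)" if "k \<le> 2" for k
    unfolding S_def using avoid that
    by (intro off_centre_collinear_if_span_avoids_centre) (auto simp: centre)
  have "p \<in> S 0 \<union> S 1 \<union> S 2" if p: "p \<in> ({-1, 0, 1} \<times> {-1, 0, 1}) - {(0, 0)}" for p
  proof -
    have "p \<in> set grid_points"
      using p by (auto simp: set_grid_points)
    then obtain j where j: "j < length grid_points" "grid_points ! j = p"
      by (metis in_set_conv_nth)
    have "j \<noteq> 4"
      using j(2) p by (auto simp: grid_points_def)
    with j have "grid_form p \<in> (\<Union>k\<in>{0..2}. A k)"
      unfolding A by (auto simp: magic_forms_eq_grid intro!: exI[of _ j])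
    also have "{0..2} = {0, 1, 2::nat}"
      by auto
    finally show ?thesis
      by (auto simp: S_def)
  qed
  then show False
    using centre_not_covered_by_three[OF lines[of 0] lines[of 1] lines[of 2]] by auto
qed

lemma complexity_magic_forms: "complexity magic_forms = 3"
proof -
  let ?P = "\<lambda>s. \<forall>i<length magic_forms. i_complexity_at_most magic_forms i s"
  have le_3: "?P 3"
    using magic_forms_i_complexity_le_3 by blast
  have "3 \<le> s" if "?P s" for s
  proof (rule ccontr)
    assume "\<not> 3 \<le> s"
    moreover have "i_complexity_at_most magic_forms 4 s"
      using that by (simp add: magic_forms_eq_grid length_grid_points)
    ultimately show False
      using i_complexity_at_most_mono[of magic_forms 4 s 2] magic_forms_centre_not_i_complexity_2
      by simp
  qed
  with le_3 have "(LEAST s. ?P s) = 3"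
    by (intro Least_equality) auto
  with le_3 show ?thesis
    unfolding complexity_def by (auto simp: numeral_eq_enat)
qed

section \<open>Parametrization of magic squares\<close>

lemma entries_eq_values_iff:
  "entries M = map (\<lambda>\<psi>. \<psi> v) magic_forms \<longleftrightarrow>
     M = vector [vector [v$1 + v$2, v$1 - v$2 - v$3, v$1 + v$3],
                 vector [v$1 - v$2 + v$3, v$1, v$1 + v$2 - v$3],
                 vector [v$1 - v$3, v$1 + v$2 + v$3, v$1 - v$2]]"
  by (simp add: entries_def magic_forms_def Let_def vec_eq_iff forall_3)

lemma magic_square_centre:
  assumes "magic_square M"
  shows "(\<Sum>j\<in>UNIV. M $ i $ j) = 3 * M $ 2 $ 2"
    and "(\<Sum>i\<in>UNIV. M $ i $ j) = 3 * M $ 2 $ 2"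
    and "M $ 1 $ 1 + M $ 3 $ 3 = 2 * M $ 2 $ 2"
    and "M $ 1 $ 3 + M $ 3 $ 1 = 2 * M $ 2 $ 2"
proof -
  obtain \<sigma> where \<sigma>: "\<forall>i. (\<Sum>j\<in>UNIV. M $ i $ j) = \<sigma>" "\<forall>j. (\<Sum>i\<in>UNIV. M $ i $ j) = \<sigma>"
    "M $ 1 $ 1 + M $ 2 $ 2 + M $ 3 $ 3 = \<sigma>" "M $ 1 $ 3 + M $ 2 $ 2 + M $ 3 $ 1 = \<sigma>"
    using assms unfolding magic_square_def by blast
  have "\<sigma> = 3 * M $ 2 $ 2"
    using \<sigma> unfolding forall_3 sum_3 by linarith
  with \<sigma> show "(\<Sum>j\<in>UNIV. M $ i $ j) = 3 * M $ 2 $ 2" "(\<Sum>i\<in>UNIV. M $ i $ j) = 3 * M $ 2 $ 2"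
    "M $ 1 $ 1 + M $ 3 $ 3 = 2 * M $ 2 $ 2" "M $ 1 $ 3 + M $ 3 $ 1 = 2 * M $ 2 $ 2"
    by auto
qed

lemma magic_square_iff_parametrized:
  "magic_square M \<longleftrightarrow> (\<exists>v. entries M = map (\<lambda>\<psi>. \<psi> v) magic_forms)"
proof
  assume M: "magic_square M"
  define v :: "int ^ 3" where
    "v = vector [M $ 2 $ 2, M $ 1 $ 1 - M $ 2 $ 2, M $ 1 $ 3 - M $ 2 $ 2]"
  note sums = magic_square_centre(1)[OF M, of 1] magic_square_centre(1)[OF M, of 2]
    magic_square_centre(2)[OF M, of 1] magic_square_centre(2)[OF M, of 2]
    magic_square_centre(2)[OF M, of 3] magic_square_centre(3,4)[OF M]
  have "entries M = map (\<lambda>\<psi>. \<psi> v) magic_forms"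
    using sums unfolding entries_def magic_forms_def v_def Let_def sum_3 by simp
  then show "\<exists>v. entries M = map (\<lambda>\<psi>. \<psi> v) magic_forms" ..
next
  assume "\<exists>v. entries M = map (\<lambda>\<psi>. \<psi> v) magic_forms"
  then obtain v where "entries M = map (\<lambda>\<psi>. \<psi> v) magic_forms" ..
  then show "magic_square M"
    unfolding entries_eq_values_iff magic_square_def
    by (intro exI[of _ "3 * v $ 1"]) (simp add: forall_3 sum_3)
qed

lemma magic_forms_parametrize_magic_squares:
  "bij_betw (\<lambda>v. map (\<lambda>\<psi>. \<psi> v) magic_forms) UNIV (entries ` {M. magic_square M})"
proof (rule bij_betw_imageI)
  show "inj (\<lambda>v. map (\<lambda>\<psi>. \<psi> v) magic_forms)"
    by (rule injI) (auto simp: magic_forms_def Let_def vec_eq_iff forall_3)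
  have "\<exists>M. entries M = map (\<lambda>\<psi>. \<psi> v) magic_forms" for v
    unfolding entries_eq_values_iff by blast
  then show "range (\<lambda>v. map (\<lambda>\<psi>. \<psi> v) magic_forms) = entries ` {M. magic_square M}"
    unfolding magic_square_iff_parametrized by (auto simp: image_iff) metis
qed

theorem lemma4:
  "(\<forall>\<psi>\<in>set magic_forms. linear_form \<psi>) \<and>
   bij_betw (\<lambda>v. map (\<lambda>\<psi>. \<psi> v) magic_forms) UNIV (entries ` {M. magic_square M}) \<and>
   complexity magic_forms = 3"
  using linear_form_grid_form magic_forms_parametrize_magic_squares complexity_magic_forms
  by (auto simp: magic_forms_eq_grid)

end
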